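(* Let $\mathcal F$ be a semifilter, let $S=\{f_\alpha : \alpha<\mathfrak b(\mathcal F)\}$ be a $\mathfrak b(\mathcal F)$-scale, and let $X=S\cup Q$, viewed as a subspace of $\overline{\mathbb N}^{\uparrow\mathbb N}$. Then for each continuous $\Psi:X\to\mathbb N^{\mathbb N}$ there exists $A\in\mathcal F^+$ such that $\Psi[X]$ is bounded with respect to $\le_{\mathcal F_A}$.
   Context: $\mathbb N=\{0,1,2,\dots\}$, discrete; $\mathbb N^{\mathbb N}$ has the product topology. $[\mathbb N]^{\aleph_0}$ is the family of infinite subsets of $\mathbb N$; $A\subseteq^*B$ means $A\setminus B$ is finite. A semifilter is a nonempty $\mathcal F\subseteq[\mathbb N]^{\aleph_0}$ such that $A\in\mathcal F$, $B\subseteq\mathbb N$ and $A\subseteq^*B$ imply $B\in\mathcal F$. For $f,g\in\mathbb N^{\mathbb N}$, $[f\le g]=\{n:f(n)\le g(n)\}$, and $f\le_{\mathcal F}g$ means $[f\le g]\in\mathcal F$. A set $Y\subseteq\mathbb N^{\mathbb N}$ is bounded with respect to $\le_{\mathcal F}$ if there is $g\in\mathbb N^{\mathbb N}$ with $f\le_{\mathcal F}g$ for all $f\in Y$; otherwise it is unbounded. $\mathfrak b(\mathcal F)$ is the minimal cardinality of a subset of $\mathbb N^{\mathbb N}$ that is unbounded with respect to $\le_{\mathcal F}$. $\mathbb N^{\uparrow\mathbb N}$ is the set of (strictly) increasing elements of $\mathbb N^{\mathbb N}$. A $\mathfrak b(\mathcal F)$-scale is a family $S=\{f_\alpha:\alpha<\mathfrak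 b(\mathcal F)\}\subseteq\mathbb N^{\uparrow\mathbb N}$ that is unbounded with respect to $\le_{\mathcal F}$ and satisfies $f_\alpha\le_{\mathcal F}f_\beta$ for all $\alpha<\beta<\mathfrak b(\mathcal F)$. $\overline{\mathbb N}=\mathbb N\cup\{\infty\}$ is the one-point compactification of $\mathbb N$. $\overline{\mathbb N}^{\uparrow\mathbb N}$ is the subspace of the product $\overline{\mathbb N}^{\mathbb N}$ consisting of the nondecreasing $f$ such that $f(n)<f(n+1)$ whenever $f(n)<\infty$. $Q$ is the (countable) set of all $f\in\overline{\mathbb N}^{\uparrow\mathbb N}$ that take the value $\infty$; thus $\overline{\mathbb N}^{\uparrow\mathbb N}=Q\cup\mathbb N^{\uparrow\mathbb N}$. $\mathcal F^+=\{A\subseteq\mathbb N:\mathbb N\setminus A\notin\mathcal F\}$. For $A\in\mathcal F^+$, $\mathcal F_A=\{C\subseteq\mathbb N:(\exists B\in\mathcal F)\ B\cap A\subseteq C\}$, which is a semifilter. *)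

theory Defs
  imports "HOL-Analysis.Analysis"
begin

unbundle cardinal_syntax

definition almost_subset :: "nat set \<Rightarrow> nat set \<Rightarrow> bool" (infix "\<subseteq>\<^sup>*" 50) where
  "A \<subseteq>\<^sup>* B \<longleftrightarrow> finite (A - B)"

definition semifilter :: "nat set set \<Rightarrow> bool" where
  "semifilter F \<longleftrightarrow> F \<noteq> {} \<and> (\<forall>A\<in>F. infinite A) \<and> (\<forall>A\<in>F. \<forall>B. A \<subseteq>\<^sup>* B \<longrightarrow> B \<in> F)"

definition le_mod :: "nat set set \<Rightarrow> (nat \<Rightarrow> nat) \<Rightarrow> (nat \<Rightarrow> nat) \<Rightarrow> bool" where
  "le_mod F f g \<longleftrightarrow> {n. f n \<le> g n} \<in> F"

definition bounded_mod :: "nat set set \<Rightarrow> (nat \<Rightarrow> nat) set \<Rightarrow> bool" where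
  "bounded_mod F Y \<longleftrightarrow> (\<exists>g. \<forall>f\<in>Y. le_mod F f g)"

text \<open>Cardinals are well-orders of minimal length on their fields, as in the theory
  \<^verbatim>\<open>BNF_Cardinal_Order_Relation\<close>. The choice operator picks a representative; the lemma below
  shows that one exists for every semifilter, and any two of them are order isomorphic.\<close>

definition frak_b :: "nat set set \<Rightarrow> (nat \<Rightarrow> nat) rel" where
  "frak_b F = (SOME r. (\<exists>Y. \<not> bounded_mod F Y \<and> r = |Y| ) \<and>
                       (\<forall>Y. \<not> bounded_mod F Y \<longrightarrow> r \<le>o |Y| ))"

lemma frak_b_minimal:
  assumes "semifilter F"
  shows "\<exists>Y. \<not> bounded_mod F Y \<and> frak_b F = |Y|"
    and "\<And>Y. \<not> bounded_mod F Y \<Longrightarrow> frak_b F \<le>o |Y|"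
proof -
  have "\<not> bounded_mod F UNIV"
  proof
    assume "bounded_mod F UNIV"
    then obtain g where "le_mod F (\<lambda>n. Suc (g n)) g"
      unfolding bounded_mod_def by blast
    then have "{} \<in> F"
      by (simp add: le_mod_def)
    then show False
      using assms by (auto simp: semifilter_def)
  qed
  then have "\<exists>r \<in> card_of ` {Y. \<not> bounded_mod F Y}. \<forall>r' \<in> card_of ` {Y. \<not> bounded_mod F Y}. r \<le>o r'"
    by (intro exists_minim_Card_order) (auto simp: card_of_Card_order)
  then have "\<exists>r. (\<exists>Y. \<not> bounded_mod F Y \<and> r = |Y| ) \<and> (\<forall>Y. \<not> bounded_mod F Y \<longrightarrow> r \<le>o |Y| )"
    by blast
  then have *: "(\<exists>Y. \<not> bounded_mod F Y \<and> frak_b F = |Y| ) \<and>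
      (\<forall>Y. \<not> bounded_mod F Y \<longrightarrow> frak_b F \<le>o |Y| )"
    unfolding frak_b_def by (rule someI_ex)
  show "\<exists>Y. \<not> bounded_mod F Y \<and> frak_b F = |Y|"
    and "\<And>Y. \<not> bounded_mod F Y \<Longrightarrow> frak_b F \<le>o |Y|"
    using * by blast+
qed

text \<open>The ordinals below \<^verbatim>\<open>b(F)\<close> are represented by the field of an arbitrary well-order \<open>r\<close>
  (over an arbitrary type) that is isomorphic to the initial ordinal \<^term>\<open>frak_b F\<close>;
  \<open>\<alpha> < \<beta>\<close> becomes \<open>(\<alpha>, \<beta>) \<in> r\<close> and \<open>\<alpha> \<noteq> \<beta>\<close>.\<close>

definition b_scale :: "nat set set \<Rightarrow> 'i rel \<Rightarrow> ('i \<Rightarrow> nat \<Rightarrow> nat) \<Rightarrow> bool" where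
  "b_scale F r f \<longleftrightarrow>
     r =o frak_b F \<and>
     (\<forall>\<alpha>\<in>Field r. strict_mono (f \<alpha>)) \<and>
     \<not> bounded_mod F (f ` Field r) \<and>
     (\<forall>\<alpha> \<beta>. (\<alpha>, \<beta>) \<in> r \<and> \<alpha> \<noteq> \<beta> \<longrightarrow> le_mod F (f \<alpha>) (f \<beta>))"

text \<open>The topology of \<^typ>\<open>enat\<close> is that of the one-point compactification of the discrete
  space \<^typ>\<open>nat\<close>, see \<^verbatim>\<open>open_enat_iff\<close>. Function types carry the product topology.\<close>

definition inc_enat :: "(nat \<Rightarrow> enat) set" where
  "inc_enat = {f. mono f \<and> (\<forall>n. f n < \<infinity> \<longrightarrow> f n < f (Suc n))}"

definition Q_enat :: "(nat \<Rightarrow> enat) set" where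
  "Q_enat = {f \<in> inc_enat. \<exists>n. f n = \<infinity>}"

definition semifilter_plus :: "nat set set \<Rightarrow> nat set set" where
  "semifilter_plus F = {A. - A \<notin> F}"

definition semifilter_restrict :: "nat set set \<Rightarrow> nat set \<Rightarrow> nat set set" where
  "semifilter_restrict F A = {C. \<exists>B\<in>F. B \<inter> A \<subseteq> C}"

end

theory Submission
  imports Defs
begin

text \<open>Write \<open>X = S \<union> Q\<close>. Since the space of increasing sequences is compact and those with
  \<open>x n = \<infinity>\<close> all belong to \<open>Q\<close>, continuity on \<open>Q\<close> yields \<open>h\<close> such that \<open>h n \<le> x n\<close> implies
  \<open>\<Psi> x n \<le> h n\<close> for all \<open>x\<close> in \<open>X\<close>. As the scale is unbounded, some \<open>f \<alpha>\<close> is not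
  below \<open>h\<close>, so \<open>A = [h < f \<alpha>]\<close> is in \<open>F\<^sup>+\<close>. For \<open>\<beta> > \<alpha>\<close>, the set \<open>[f \<alpha> \<le> f \<beta>] \<inter> A\<close>
  is contained in \<open>[\<Psi> (f \<beta>) \<le> h]\<close>. The remaining points are the countable set \<open>Q\<close> and
  the fewer than \<open>b(F)\<close> many \<open>f \<beta>\<close> with \<open>\<beta> < \<alpha>\<close>, whose images are bounded
  modulo \<open>F\<close>.\<close>

lemma cofinite_in_semifilter:
  assumes "semifilter F" and "finite (- B)"
  shows "B \<in> F"
proof -
  obtain A where "A \<in> F"
    using assms(1) by (auto simp: semifilter_def)
  moreover have "A \<subseteq>\<^sup>* B"
    using finite_subset[OF _ assms(2), of "A - B"] by (auto simp: almost_subset_def)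
  ultimately show ?thesis
    using assms(1) by (auto simp: semifilter_def)
qed

text \<open>Diagonalization: the maximum at \<open>n\<close> of the functions with index at most
  \<open>n\<close> eventually dominates each of them, and cofinite sets belong to every
  semifilter.\<close>

lemma countable_imp_bounded_mod:
  assumes "semifilter F" and "countable Y"
  shows "bounded_mod F Y"
proof (cases "Y = {}")
  case False
  define y where "y = from_nat_into Y"
  define g where "g n = Max ((\<lambda>k. y k n) ` {..n})" for n
  have "le_mod F (y k) g" for k
  proof -
    have "y k n \<le> g n" if "k \<le> n" for n
      unfolding g_def using that by (intro Max_ge) auto
    then have "- {n. y k n \<le> g n} \<subseteq> {..<k}"
      by (auto simp: not_le intro: leI)
    then show ?thesis
      unfolding le_mod_def by (intro cofinite_in_semifilter[OF assms(1)]) (rule finite_subset, auto)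
  qed
  moreover have "range y = Y"
    unfolding y_def using False assms(2) by (rule range_from_nat_into)
  ultimately show ?thesis
    unfolding bounded_mod_def by blast
qed (simp add: bounded_mod_def)

text \<open>By monotonicity, a member is determined by the finite list of its values before the
  first \<infinity>.\<close>

lemma countable_Q_enat: "countable Q_enat"
proof -
  have "Q_enat \<subseteq> range (\<lambda>l i. if i < length l then enat (l ! i) else \<infinity>)"
  proof
    fix x assume "x \<in> Q_enat"
    then have "mono x" and ex: "\<exists>n. x n = \<infinity>"
      by (auto simp: Q_enat_def inc_enat_def)
    define m where "m = (LEAST n. x n = \<infinity>)"
    have "x m = \<infinity>"
      unfolding m_def using ex by (rule LeastI_ex)
    then have "x i = \<infinity>" if "m \<le> i" for i
      using monoD[OF \<open>mono x\<close> that] by simp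
    moreover have "x i = enat (the_enat (x i))" if "i < m" for i
      using not_less_Least[OF that[unfolded m_def]] by (cases "x i") auto
    ultimately have "x = (\<lambda>i. if i < length (map (the_enat \<circ> x) [0..<m])
        then enat (map (the_enat \<circ> x) [0..<m] ! i) else \<infinity>)"
      by (auto simp: fun_eq_iff)
    then show "x \<in> range (\<lambda>l i. if i < length l then enat (l ! i) else \<infinity>)"
      by (rule range_eqI)
  qed
  then show ?thesis
    by (rule countable_subset) simp
qed

lemma tendsto_product_coordinate:
  fixes l :: "'a \<Rightarrow> 'b :: topological_space"
  assumes "(x \<longlongrightarrow> l) G"
  shows "((\<lambda>k. x k i) \<longlongrightarrow> l i) G"
  using continuous_on_tendsto_compose[OF continuous_on_product_coordinates assms] by simp

text \<open>Monotonicity passes to limits directly; strict growth at finite values does so because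
  finite points of \<open>enat\<close> are isolated.\<close>

lemma closed_inc_enat: "closed inc_enat"
proof -
  have "l \<in> inc_enat" if x: "\<And>k. x k \<in> inc_enat" and lim: "x \<longlonglongrightarrow> l" for x l
  proof -
    have lim': "(\<lambda>k. x k i) \<longlonglongrightarrow> l i" for i
      using lim by (rule tendsto_product_coordinate)
    have "mono l"
    proof (rule monoI)
      fix i j :: nat assume "i \<le> j"
      then have "x k i \<le> x k j" for k
        using x[of k] by (auto simp: inc_enat_def mono_def)
      then show "l i \<le> l j"
        by (intro LIMSEQ_le[OF lim' lim']) auto
    qed
    moreover have "l i < l (Suc i)" if "l i < \<infinity>" for i
    proof -
      have "open {l i}"
        using that by (cases "l i") (auto simp: open_enat)
      then have "\<forall>\<^sub>F k in sequentially. x k i \<in> {l i}"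
        by (rule topological_tendstoD[OF lim']) simp
      \<comment> \<open>Strict inequalities may be lost in the limit, so the strict one is recast as
        a weak one with \<open>eSuc\<close>.\<close>
      then have "\<forall>\<^sub>F k in sequentially. eSuc (l i) \<le> x k (Suc i)"
      proof eventually_elim
        case (elim k)
        then have "x k i < x k (Suc i)"
          using x[of k] that unfolding inc_enat_def by (metis (mono_tags, lifting) mem_Collect_eq singletonD)
        then show ?case
          using elim by (auto intro: ileI1)
      qed
      then have "eSuc (l i) \<le> l (Suc i)"
        by (intro tendsto_lowerbound[OF lim']) auto
      then show ?thesis
        using that by (cases "l i") (auto simp: eSuc_enat Suc_ile_eq)
    qed
    ultimately show ?thesis
      by (simp add: inc_enat_def)
  qed
  then show ?thesis
    unfolding closed_sequential_limits by blast
qed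

text \<open>Tychonoff's theorem, in the sequential form that suits a sequence of
  counterexamples.\<close>

lemma seq_compact_UNIV_enat_fun: "seq_compact (UNIV :: (nat \<Rightarrow> enat) set)"
proof -
  have "compact_space (product_topology (\<lambda>i::nat. (euclidean :: enat topology)) UNIV)"
    unfolding compact_space_product_topology
    using compact_UNIV[where 'a = enat] by (simp add: compact_space_def)
  then have "compact (UNIV :: (nat \<Rightarrow> enat) set)"
    unfolding euclidean_product_topology compact_space_def by simp
  then show ?thesis
    by (rule compact_imp_seq_compact)
qed

text \<open>If every \<open>h\<close> failed, counterexamples would accumulate at a point with
  \<open>n\<close>-th coordinate \<infinity>. It lies in \<open>Q_enat\<close>, hence in
  \<open>X\<close>, and continuity there keeps the values of \<Psi> at \<open>n\<close> bounded
  along a subsequence.\<close>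

lemma continuous_on_large_coordinate_bound:
  fixes \<Psi> :: "(nat \<Rightarrow> enat) \<Rightarrow> nat \<Rightarrow> nat"
  assumes "X \<subseteq> inc_enat" and "Q_enat \<subseteq> X" and "continuous_on X \<Psi>"
  shows "\<exists>h. \<forall>x\<in>X. enat h \<le> x n \<longrightarrow> \<Psi> x n \<le> h"
proof (rule ccontr)
  assume "\<not> ?thesis"
  \<comment> \<open>\<open>x k\<close> is a counterexample to the choice
    \<open>h = k\<close>.\<close>
  then obtain x where x: "\<And>k. x k \<in> X" "\<And>k. enat k \<le> x k n" "\<And>k. k < \<Psi> (x k) n"
    by (metis not_le)
  obtain l s where s: "strict_mono (s :: nat \<Rightarrow> nat)" and lim: "(x \<circ> s) \<longlonglongrightarrow> l"
    using seq_compact_UNIV_enat_fun unfolding seq_compact_def by (metis UNIV_I)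
  have "l \<in> inc_enat"
    using closed_inc_enat lim x(1) assms(1)
    unfolding closed_sequential_limits by (metis comp_apply subsetD)
  moreover have "l n = \<infinity>"
  proof -
    have "enat i \<le> l n" for i
    proof (rule tendsto_lowerbound)
      show "(\<lambda>k. x (s k) n) \<longlonglongrightarrow> l n"
        using tendsto_product_coordinate[OF lim] by (simp add: o_def)
      have "enat i \<le> x (s k) n" if "i \<le> k" for k
        using that seq_suble[OF s, of k] x(2)[of "s k"] by (meson enat_ord_simps(1) order_trans)
      then show "\<forall>\<^sub>F k in sequentially. enat i \<le> x (s k) n"
        by (rule eventually_sequentiallyI)
    qed simp
    then show ?thesis
      by (metis Suc_ile_eq enat.exhaust less_irrefl)
  qed
  ultimately have "l \<in> X"
    using assms(2) by (auto simp: Q_enat_def)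
  have "(\<lambda>k. \<Psi> (x (s k))) \<longlonglongrightarrow> \<Psi> l"
    using continuous_on_tendsto_compose[OF assms(3) lim \<open>l \<in> X\<close>] x(1) by simp
  then have "(\<lambda>k. \<Psi> (x (s k)) n) \<longlonglongrightarrow> \<Psi> l n"
    by (rule tendsto_product_coordinate)
  \<comment> \<open>As \<open>nat\<close> is discrete, a convergent sequence is eventually
    constant.\<close>
  then have "\<forall>\<^sub>F k in sequentially. \<Psi> (x (s k)) n \<in> {\<Psi> l n}"
    by (rule topological_tendstoD) (auto simp: open_discrete)
  moreover have "\<forall>\<^sub>F k in sequentially. \<Psi> l n < k"
    by (rule eventually_gt_at_top)
  ultimately have "\<forall>\<^sub>F k::nat in sequentially. False"
  proof eventually_elim
    case (elim k)
    then show ?case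
      using x(3)[of "s k"] seq_suble[OF s, of k] by simp
  qed
  then show False
    by simp
qed

text \<open>Since \<open>r\<close> is isomorphic to an initial ordinal, its proper initial segments
  have cardinality below \<open>frak_b F\<close>, and so do their images.\<close>

lemma bounded_mod_initial_segment:
  assumes "semifilter F" and r: "(r, frak_b F) \<in> ordIso" and "\<alpha> \<in> Field r"
  shows "bounded_mod F (g ` underS r \<alpha>)"
proof (rule ccontr)
  assume "\<not> ?thesis"
  then have "frak_b F \<le>o |g ` underS r \<alpha>|"
    by (rule frak_b_minimal(2)[OF assms(1)])
  also have "|g ` underS r \<alpha>| \<le>o |underS r \<alpha>|"
    by (rule card_of_image)
  finally have "frak_b F \<le>o |underS r \<alpha>|" .
  then have "r \<le>o |underS r \<alpha>|"
    using r ordIso_ordLeq_trans by blast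
  moreover obtain Y :: "(nat \<Rightarrow> nat) set" where "frak_b F = |Y|"
    using frak_b_minimal(1)[OF assms(1)] by blast
  then have "Card_order r"
    using r card_of_Card_order Card_order_ordIso by metis
  then have "|underS r \<alpha>| <o r"
    using assms(3) by (rule card_of_underS)
  ultimately show False
    using not_ordLess_ordLeq by blast
qed

text \<open>The witness \<open>B\<close> may vary with \<open>y\<close>, whereas \<open>g\<close> is
  common to all of \<open>Y\<close>.\<close>

lemma bounded_mod_semifilter_restrictI:
  assumes "\<And>y. y \<in> Y \<Longrightarrow> \<exists>B\<in>F. \<forall>n\<in>B \<inter> A. y n \<le> g n"
  shows "bounded_mod (semifilter_restrict F A) Y"
  unfolding bounded_mod_def le_mod_def semifilter_restrict_def
  using assms by (intro exI[of _ g] ballI CollectI) (simp add: subset_eq)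

theorem theorem2p14:
  fixes F :: "nat set set"
    and r :: "'i rel"
    and f :: "'i \<Rightarrow> nat \<Rightarrow> nat"
    and X :: "(nat \<Rightarrow> enat) set"
    and \<Psi> :: "(nat \<Rightarrow> enat) \<Rightarrow> (nat \<Rightarrow> nat)"
  assumes "semifilter F"
    and "b_scale F r f"
    and "X = (\<lambda>\<alpha>. enat \<circ> f \<alpha>) ` Field r \<union> Q_enat"
    and "continuous_on X \<Psi>"
  shows "\<exists>A\<in>semifilter_plus F. bounded_mod (semifilter_restrict F A) (\<Psi> ` X)"
proof -
  have r: "(r, frak_b F) \<in> ordIso"
    and inc: "\<And>\<alpha>. \<alpha> \<in> Field r \<Longrightarrow> strict_mono (f \<alpha>)"
    and unb: "\<not> bounded_mod F (f ` Field r)"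
    and le: "\<And>\<alpha> \<beta>. (\<alpha>, \<beta>) \<in> r \<Longrightarrow> \<alpha> \<noteq> \<beta> \<Longrightarrow> le_mod F (f \<alpha>) (f \<beta>)"
    using assms(2) by (auto simp: b_scale_def)
  have "X \<subseteq> inc_enat"
    using inc by (auto simp: assms(3) Q_enat_def inc_enat_def strict_mono_def mono_def
        strict_mono_less_eq)
  moreover have "Q_enat \<subseteq> X"
    by (simp add: assms(3))
  ultimately have "\<exists>h. \<forall>x\<in>X. enat h \<le> x n \<longrightarrow> \<Psi> x n \<le> h" for n
    using assms(4) by (rule continuous_on_large_coordinate_bound)
  then obtain h where h: "\<And>n x. x \<in> X \<Longrightarrow> enat (h n) \<le> x n \<Longrightarrow> \<Psi> x n \<le> h n"
    by metis
  obtain \<alpha> where \<alpha>: "\<alpha> \<in> Field r" "\<not> le_mod F (f \<alpha>) h"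
    using unb by (auto simp: bounded_mod_def)
  define A where "A = {n. h n < f \<alpha> n}"
  have "- A = {n. f \<alpha> n \<le> h n}"
    by (auto simp: A_def)
  then have "A \<in> semifilter_plus F"
    using \<alpha>(2) by (simp add: semifilter_plus_def le_mod_def)
  obtain g1 where g1: "\<And>\<beta>. \<beta> \<in> underS r \<alpha> \<Longrightarrow> le_mod F (\<Psi> (enat \<circ> f \<beta>)) g1"
    using bounded_mod_initial_segment[OF assms(1) r \<alpha>(1), of "\<lambda>\<beta>. \<Psi> (enat \<circ> f \<beta>)"]
    by (auto simp: bounded_mod_def)
  obtain g2 where g2: "\<And>q. q \<in> Q_enat \<Longrightarrow> le_mod F (\<Psi> q) g2"
    using countable_imp_bounded_mod[OF assms(1) countable_image[OF countable_Q_enat, of \<Psi>]]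
    by (auto simp: bounded_mod_def)
  define g where "g n = max (h n) (max (g1 n) (g2 n))" for n
  have "bounded_mod (semifilter_restrict F A) (\<Psi> ` X)"
  proof (rule bounded_mod_semifilter_restrictI)
    fix y assume "y \<in> \<Psi> ` X"
    then consider (Q) q where "q \<in> Q_enat" "y = \<Psi> q"
      | (S) \<beta> where "\<beta> \<in> Field r" "y = \<Psi> (enat \<circ> f \<beta>)"
      using assms(3) by blast
    then show "\<exists>B\<in>F. \<forall>n\<in>B \<inter> A. y n \<le> g n"
    proof cases
      case Q
      then show ?thesis
        using g2 by (intro bexI[of _ "{n. y n \<le> g2 n}"]) (auto simp: le_mod_def g_def)
    next
      case (S \<beta>)
      have "Well_order r"
        using r unfolding ordIso_def by auto
      then consider "\<beta> \<in> underS r \<alpha>" | "\<beta> = \<alpha>" | "(\<alpha>, \<beta>) \<in> r" "\<alpha> \<noteq> \<beta>"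
        using S(1) \<alpha>(1) unfolding underS_def order_on_defs total_on_def by blast
      then show ?thesis
      proof cases
        case 1
        then show ?thesis
          using g1 S by (intro bexI[of _ "{n. y n \<le> g1 n}"]) (auto simp: le_mod_def g_def)
      next
        \<comment> \<open>On \<open>A\<close> this gives
          \<open>h n < f \<alpha> n \<le> f \<beta> n\<close>, so the threshold in \<open>h\<close>
          is reached.\<close>
        have *: "y n \<le> g n" if "f \<alpha> n \<le> f \<beta> n" "n \<in> A" for n
          using that h[of "enat \<circ> f \<beta>" n] S assms(3) by (auto simp: A_def g_def)
        {
          case 2
          then show ?thesis
            \<comment> \<open>For \<beta> = \<alpha> the comparison holds everywhere, so
              \<open>B = UNIV\<close> serves.\<close>
            using * cofinite_in_semifilter[OF assms(1), of UNIV] by auto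
        next
          case 3
          then show ?thesis
            using * le by (intro bexI[of _ "{n. f \<alpha> n \<le> f \<beta> n}"]) (auto simp: le_mod_def)
        }
      qed
    qed
  qed
  with \<open>A \<in> semifilter_plus F\<close> show ?thesis ..
qed

end
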